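(* Suppose that for some unit cost $\bar c\ge 0$ there are two distinct optimal sets. Then there exists $\varepsilon>0$ such that the maximal optimal set for $\bar c$ is optimal for all $c\in(\bar c-\varepsilon,\bar c]$ and the minimal optimal set for $\bar c$ is optimal for all $c\in[\bar c,\bar c+\varepsilon)$. In particular, $\bar c$ is a corner point of the function $c\mapsto PPTP(N,c)$.
   Context: Setting (PPTP on a line). The depot is at the origin of the half-line $[0,\infty)$. $N=\{v_1,\dots,v_n\}$ ($n\ge 1$) is the set of potential customers; customer $v_i$ has position $x_i>0$, prize $p_i>0$ and probability $\pi_i\in(0,1]$. Customers are indexed so that $x_i\le x_{i+1}$, and $x_i=x_{i+1}$ implies $\pi_i\le\pi_{i+1}$. Put $l_i=2x_i$. For $S\subseteq N$ define the expected revenue $R(S)=\sum_{v_i\in S}\pi_ip_i$, the expected distance $L(S)=\sum_{v_i\in S} l_i\pi_i\prod_{v_j\in S,\,j>i}(1-\pi_j)$ and, for a unit cost $c\ge 0$, the expected profit $G(S,c)=R(S)-cL(S)$. Empty sums are $0$, empty products are $1$. $PPTP(N,c)=\max_{S\subseteq N}G(S,c)$ for $c\ge0$; a set $S\subseteq N$ attaining the maximum is called an optimal set for $c$. Maximal and minimal optimal sets for a given $c$ are meant with respect to inclusion; for each $c\ge 0$ each of them exists and is unique. The function $c\mapsto PPTP(N,c)$ on $[0,\infty)$ is piecewise linear, and a corner point is a point $c>0$ at which its slope changes (the left and right slopes differ). *)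

theory Defs
  imports Complex_Main
begin

text \<open>
  Customer \<open>v\<^sub>i\<close> is represented by its index \<open>i \<in> {1..n}\<close>, so a set of customers is a subset of
  \<open>{1..n}\<close>; \<open>x i\<close>, \<open>p i\<close> and \<open>q i\<close> are the position, the prize and the probability of \<open>v\<^sub>i\<close>.
  Values outside \<open>{1..n}\<close> are irrelevant.
\<close>

locale pptp_line =
  fixes n :: nat and x p q :: "nat \<Rightarrow> real"
  assumes n_ge_1: "1 \<le> n"
    and position_pos: "i \<in> {1..n} \<Longrightarrow> 0 < x i"
    and prize_pos: "i \<in> {1..n} \<Longrightarrow> 0 < p i"
    and prob_range: "i \<in> {1..n} \<Longrightarrow> q i \<in> {0<..1}"
    and position_sorted: "i \<in> {1..<n} \<Longrightarrow> x i \<le> x (i + 1)"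
    and prob_sorted: "i \<in> {1..<n} \<Longrightarrow> x i = x (i + 1) \<Longrightarrow> q i \<le> q (i + 1)"

definition expected_revenue :: "(nat \<Rightarrow> real) \<Rightarrow> (nat \<Rightarrow> real) \<Rightarrow> nat set \<Rightarrow> real" where
  "expected_revenue p q S = (\<Sum>i\<in>S. q i * p i)"

definition expected_distance :: "(nat \<Rightarrow> real) \<Rightarrow> (nat \<Rightarrow> real) \<Rightarrow> nat set \<Rightarrow> real" where
  "expected_distance x q S = (\<Sum>i\<in>S. (2 * x i) * q i * (\<Prod>j\<in>{j \<in> S. j > i}. 1 - q j))"

definition expected_profit ::
  "(nat \<Rightarrow> real) \<Rightarrow> (nat \<Rightarrow> real) \<Rightarrow> (nat \<Rightarrow> real) \<Rightarrow> nat set \<Rightarrow> real \<Rightarrow> real" where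
  "expected_profit x p q S c = expected_revenue p q S - c * expected_distance x q S"

definition PPTP ::
  "nat \<Rightarrow> (nat \<Rightarrow> real) \<Rightarrow> (nat \<Rightarrow> real) \<Rightarrow> (nat \<Rightarrow> real) \<Rightarrow> real \<Rightarrow> real" where
  "PPTP n x p q c = Max ((\<lambda>S. expected_profit x p q S c) ` Pow {1..n})"

text \<open>
  The problem is posed only for unit costs \<open>c \<ge> 0\<close>, so no set is optimal for a negative \<open>c\<close>.
\<close>

definition optimal_set ::
  "nat \<Rightarrow> (nat \<Rightarrow> real) \<Rightarrow> (nat \<Rightarrow> real) \<Rightarrow> (nat \<Rightarrow> real) \<Rightarrow> real \<Rightarrow> nat set \<Rightarrow> bool" where
  "optimal_set n x p q c S \<longleftrightarrow>
     0 \<le> c \<and> S \<subseteq> {1..n} \<and> expected_profit x p q S c = PPTP n x p q c"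

text \<open>
  The following descriptions are meant for instances satisfying \<^locale>\<open>pptp_line\<close> and \<open>c \<ge> 0\<close>,
  where the inclusion-maximal and the inclusion-minimal optimal set exist and are unique.
\<close>

definition maximal_optimal_set ::
  "nat \<Rightarrow> (nat \<Rightarrow> real) \<Rightarrow> (nat \<Rightarrow> real) \<Rightarrow> (nat \<Rightarrow> real) \<Rightarrow> real \<Rightarrow> nat set" where
  "maximal_optimal_set n x p q c =
     (THE S. optimal_set n x p q c S \<and> (\<nexists>T. optimal_set n x p q c T \<and> S \<subset> T))"

definition minimal_optimal_set ::
  "nat \<Rightarrow> (nat \<Rightarrow> real) \<Rightarrow> (nat \<Rightarrow> real) \<Rightarrow> (nat \<Rightarrow> real) \<Rightarrow> real \<Rightarrow> nat set" where
  "minimal_optimal_set n x p q c =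
     (THE S. optimal_set n x p q c S \<and> (\<nexists>T. optimal_set n x p q c T \<and> T \<subset> S))"

text \<open>
  For a piecewise linear function the slopes to the left and to the right of a point are its
  one-sided derivatives there.
\<close>

definition corner_point :: "(real \<Rightarrow> real) \<Rightarrow> real \<Rightarrow> bool" where
  "corner_point f c \<longleftrightarrow> 0 < c \<and>
     (\<exists>a b. (f has_real_derivative a) (at_left c) \<and>
            (f has_real_derivative b) (at_right c) \<and> a \<noteq> b)"

end

theory Submission imports Defs begin

text \<open>
  The proof rests on one structural fact: the expected distance \<open>L\<close> is submodular. Conditioning on
  whether the farthest customer \<open>b\<close> of a set is present gives
  \<open>L(S) = 2 x\<^sub>b q\<^sub>b + (1 - q\<^sub>b) L(S - {b})\<close>, and monotonicity and submodularity of \<open>L\<close> follow by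
  removing the farthest customer. As the expected revenue is modular, the profit is
  supermodular, so the optimal sets for \<open>cbar\<close> are closed under union and intersection; their union
  and their intersection are therefore the maximal and the minimal optimal set, and all optimal sets
  lie between them.

  For fixed \<open>S\<close> the profit is affine in the unit cost with slope \<open>-L(S)\<close>. Hence just to the left of
  \<open>cbar\<close> the best sets are those which are optimal for \<open>cbar\<close> with the largest distance, and just
  to the right those with the smallest. Optimal sets for \<open>cbar\<close> have equal profit, so they are
  ordered by \<open>cbar * L\<close> as they are by revenue, and revenue strictly increases with inclusion
  because the prizes and probabilities are positive. For \<open>cbar = 0\<close> this makes
  two optimal sets impossible; for \<open>cbar > 0\<close> it makes the maximal optimal set the one of largest
  distance and the minimal one that of smallest distance, with different slopes when the two sets
  differ.
\<close>

section \<open>Submodularity of the expected distance\<close>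

text \<open>
  The recursion behind all inductions below: if the farthest customer \<open>b\<close> is present, the tour has
  length \<open>2 * x b\<close>, and otherwise it is the tour for the remaining customers. The case \<open>b \<notin> A\<close> is
  included so that several subsets of the same \<open>insert b U\<close> can be treated alike.
\<close>

lemma expected_distance_split_last:
  assumes "finite U" "\<forall>a\<in>U. a < b" "A \<subseteq> insert b U"
  shows "expected_distance x q A =
    (if b \<in> A then 2 * x b * q b + (1 - q b) * expected_distance x q (A - {b})
     else expected_distance x q (A - {b}))"
proof (cases "b \<in> A")
  case True
  define A' where "A' = A - {b}"
  have A: "A = insert b A'" and nb: "b \<notin> A'" and fin: "finite A'" and lt: "\<And>a. a \<in> A' \<Longrightarrow> a < b"
    using True assms finite_subset[of A' U] by (auto simp: A'_def)
  have last: "{j \<in> A. j > b} = {}"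
    using lt by (auto simp: A dest: less_asym)
  have tail: "(\<Prod>j\<in>{j \<in> A. j > i}. 1 - q j) = (1 - q b) * (\<Prod>j\<in>{j \<in> A'. j > i}. 1 - q j)"
    if "i \<in> A'" for i
  proof -
    have "{j \<in> A. j > i} = insert b {j \<in> A'. j > i}"
      using lt[OF that] by (auto simp: A)
    then show ?thesis
      using fin nb by simp
  qed
  have "expected_distance x q A =
      2 * x b * q b + (\<Sum>i\<in>A'. 2 * x i * q i * (\<Prod>j\<in>{j \<in> A. j > i}. 1 - q j))"
    unfolding expected_distance_def
    using sum.insert[OF fin nb, of "\<lambda>i. 2 * x i * q i * (\<Prod>j\<in>{j \<in> A. j > i}. 1 - q j)"] last
    by (simp add: A[symmetric])
  also have "(\<Sum>i\<in>A'. 2 * x i * q i * (\<Prod>j\<in>{j \<in> A. j > i}. 1 - q j)) =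
      (1 - q b) * expected_distance x q A'"
    unfolding expected_distance_def sum_distrib_left
    by (intro sum.cong refl) (simp add: tail)
  finally show ?thesis
    using True by (simp add: A'_def)
qed simp

text \<open>
  An expected maximum is at most any bound on the values; the bound has to be nonnegative because
  the tour has length \<open>0\<close> when no customer is present.
\<close>

lemma expected_distance_le:
  assumes "finite U" "\<And>i. i \<in> U \<Longrightarrow> 0 \<le> q i \<and> q i \<le> 1" "\<And>i. i \<in> U \<Longrightarrow> x i \<le> M"
    and "0 \<le> M" "A \<subseteq> U"
  shows "expected_distance x q A \<le> 2 * M"
  using assms
proof (induction U arbitrary: A rule: finite_linorder_max_induct)
  case empty
  then show ?case by (simp add: expected_distance_def)
next
  case (insert b U)
  have IH: "expected_distance x q (A - {b}) \<le> 2 * M"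
    using insert.prems by (intro insert.IH) auto
  have q: "0 \<le> q b" "q b \<le> 1" and "x b \<le> M"
    using insert.prems by auto
  have "2 * x b * q b + (1 - q b) * expected_distance x q (A - {b}) \<le> 2 * M * q b + (1 - q b) * (2 * M)"
    using q IH \<open>x b \<le> M\<close> by (intro add_mono mult_right_mono mult_left_mono) auto
  also have "\<dots> = 2 * M"
    by (simp add: algebra_simps)
  finally show ?case
    using IH unfolding expected_distance_split_last[OF insert.hyps insert.prems(4)]
    by (cases "b \<in> A") simp_all
qed

text \<open>
  Adding the farthest customer \<open>b\<close> replaces the tour length by the larger value \<open>2 * x b\<close> with
  probability \<open>q b\<close>; this is where the order of the positions enters.
\<close>

lemma expected_distance_mono:
  assumes "finite U" "\<And>i. i \<in> U \<Longrightarrow> 0 \<le> q i \<and> q i \<le> 1" "\<And>i. i \<in> U \<Longrightarrow> 0 \<le> x i"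
    and "mono_on U x" "A \<subseteq> B" "B \<subseteq> U"
  shows "expected_distance x q A \<le> expected_distance x q B"
  using assms
proof (induction U arbitrary: A B rule: finite_linorder_max_induct)
  case empty
  then show ?case by simp
next
  case (insert b U)
  let ?L = "expected_distance x q"
  note split = expected_distance_split_last[OF insert.hyps]
  have IH: "?L (A - {b}) \<le> ?L (B - {b})"
    using insert.prems by (intro insert.IH) (auto intro: mono_on_subset)
  have q: "0 \<le> q b" "q b \<le> 1"
    using insert.prems by auto
  have "x i \<le> x b" if "i \<in> U" for i
    using insert.hyps that by (intro mono_onD[OF insert.prems(3)]) auto
  then have "?L (B - {b}) \<le> 2 * x b"
    using insert.prems insert.hyps by (intro expected_distance_le[of U]) auto
  then have "q b * ?L (B - {b}) \<le> q b * (2 * x b)"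
    using q by (intro mult_left_mono)
  moreover have "(1 - q b) * ?L (A - {b}) \<le> (1 - q b) * ?L (B - {b})"
    using q IH by (intro mult_left_mono) auto
  moreover have "A \<subseteq> insert b U" and "b \<in> A \<Longrightarrow> b \<in> B"
    using insert.prems by auto
  ultimately show ?case
    using IH unfolding split[OF \<open>A \<subseteq> insert b U\<close>] split[OF \<open>B \<subseteq> insert b U\<close>]
    by (auto simp: algebra_simps)
qed

text \<open>
  If \<open>b\<close> belongs to both or to neither of the two sets, the recursion scales the
  inequality for the remaining customers by \<open>1 - q b\<close> or by \<open>1\<close>. If \<open>b\<close> belongs to just one of them,
  say to \<open>A\<close>, the sets \<open>B\<close> and \<open>A \<inter> B\<close> keep the weight \<open>1\<close>, and the surplus
  \<open>q b * (L B - L (A \<inter> B))\<close> is nonnegative by monotonicity.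
\<close>

lemma expected_distance_submodular:
  assumes "finite U" "\<And>i. i \<in> U \<Longrightarrow> 0 \<le> q i \<and> q i \<le> 1" "\<And>i. i \<in> U \<Longrightarrow> 0 \<le> x i"
    and "mono_on U x" "A \<subseteq> U" "B \<subseteq> U"
  shows "expected_distance x q (A \<union> B) + expected_distance x q (A \<inter> B)
    \<le> expected_distance x q A + expected_distance x q B"
  using assms
proof (induction U arbitrary: A B rule: finite_linorder_max_induct)
  case empty
  then show ?case by simp
next
  case (insert b U)
  let ?L = "expected_distance x q"
  define A' B' where "A' = A - {b}" and "B' = B - {b}"
  note split = expected_distance_split_last[OF insert.hyps]
  have monoU: "mono_on U x"
    using insert.prems by (auto intro: mono_on_subset)
  have sub: "A' \<subseteq> U" "B' \<subseteq> U"
    using insert.prems by (auto simp: A'_def B'_def)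
  have diff: "A \<union> B - {b} = A' \<union> B'" "A \<inter> B - {b} = A' \<inter> B'"
    by (auto simp: A'_def B'_def)
  have q: "0 \<le> q b" "q b \<le> 1"
    using insert.prems by auto
  have IH: "?L (A' \<union> B') + ?L (A' \<inter> B') \<le> ?L A' + ?L B'"
    using insert.prems sub monoU by (intro insert.IH) auto
  have mono: "?L (A' \<inter> B') \<le> ?L A'" "?L (A' \<inter> B') \<le> ?L B'"
    using insert.prems insert.hyps sub monoU by (auto intro!: expected_distance_mono[of U])
  have scaled: "(1 - q b) * (?L (A' \<union> B') + ?L (A' \<inter> B')) \<le> (1 - q b) * (?L A' + ?L B')"
    using q IH by (intro mult_left_mono) auto
  have surplus: "q b * ?L (A' \<inter> B') \<le> q b * ?L A'" "q b * ?L (A' \<inter> B') \<le> q b * ?L B'"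
    using q mono by (auto intro: mult_left_mono)
  have AB: "A \<union> B \<subseteq> insert b U" "A \<inter> B \<subseteq> insert b U"
    using insert.prems by auto
  show ?case
    using IH scaled surplus
    unfolding split[OF AB(1)] split[OF AB(2)] split[OF insert.prems(4)] split[OF insert.prems(5)]
      diff A'_def[symmetric] B'_def[symmetric]
    by (cases "b \<in> A"; cases "b \<in> B") (simp_all add: algebra_simps)
qed

section \<open>The lattice of optimal sets\<close>

lemma optimal_set_iff:
  "optimal_set n x p q c S \<longleftrightarrow> 0 \<le> c \<and> S \<subseteq> {1..n} \<and>
     (\<forall>T\<subseteq>{1..n}. expected_profit x p q T c \<le> expected_profit x p q S c)"
proof -
  have "v = PPTP n x p q c \<longleftrightarrow> v \<in> (\<lambda>S. expected_profit x p q S c) ` Pow {1..n} \<and>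
      (\<forall>T\<subseteq>{1..n}. expected_profit x p q T c \<le> v)" for v
    unfolding PPTP_def by (subst eq_Max_iff) auto
  then show ?thesis
    unfolding optimal_set_def by auto
qed

context pptp_line
begin

lemma positions_mono: "mono_on {1..n} x"
proof (rule mono_onI)
  fix i j assume "i \<in> {1..n}" "j \<in> {1..n}" "i \<le> j"
  have "j \<le> n \<longrightarrow> x i \<le> x j"
    using \<open>i \<le> j\<close>
  proof (induction j rule: dec_induct)
    case (step k)
    then show ?case
      using position_sorted[of k] \<open>i \<in> {1..n}\<close> by fastforce
  qed simp
  then show "x i \<le> x j"
    using \<open>j \<in> {1..n}\<close> by simp
qed

lemma expected_revenue_strict_mono:
  assumes "S \<subset> T" "T \<subseteq> {1..n}"
  shows "expected_revenue p q S < expected_revenue p q T"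
proof -
  have pos: "0 < q i * p i" if "i \<in> T" for i
    using that assms prize_pos[of i] prob_range[of i] by auto
  obtain i where "i \<in> T - S"
    using assms by auto
  then show ?thesis
    unfolding expected_revenue_def
    using assms pos finite_subset[OF assms(2)]
    by (intro sum_strict_mono2[where b = i]) (auto intro: less_imp_le)
qed

lemma expected_profit_supermodular:
  assumes "S \<subseteq> {1..n}" "T \<subseteq> {1..n}" "0 \<le> c"
  shows "expected_profit x p q S c + expected_profit x p q T c
    \<le> expected_profit x p q (S \<union> T) c + expected_profit x p q (S \<inter> T) c"
proof -
  have "finite S" "finite T"
    using assms finite_subset by auto
  then have R: "expected_revenue p q (S \<union> T) + expected_revenue p q (S \<inter> T)
      = expected_revenue p q S + expected_revenue p q T"
    unfolding expected_revenue_def by (rule sum.union_inter)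
  have "expected_distance x q (S \<union> T) + expected_distance x q (S \<inter> T)
      \<le> expected_distance x q S + expected_distance x q T"
    using assms prob_range position_pos positions_mono
    by (intro expected_distance_submodular[of "{1..n}"]) (auto simp: less_imp_le)
  then have "c * (expected_distance x q (S \<union> T) + expected_distance x q (S \<inter> T))
      \<le> c * (expected_distance x q S + expected_distance x q T)"
    using \<open>0 \<le> c\<close> by (rule mult_left_mono)
  then show ?thesis
    using R by (simp add: expected_profit_def algebra_simps)
qed

text \<open>
  The two profits on the right-hand side of supermodularity are at most the optimum, and
  together at least twice the optimum.
\<close>

lemma optimal_set_Un_Int:
  assumes "optimal_set n x p q c S" "optimal_set n x p q c T"
  shows "optimal_set n x p q c (S \<union> T)" "optimal_set n x p q c (S \<inter> T)"
proof -
  have sub: "S \<subseteq> {1..n}" "T \<subseteq> {1..n}" "S \<union> T \<subseteq> {1..n}" "S \<inter> T \<subseteq> {1..n}" and c: "0 \<le> c"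
    using assms by (auto simp: optimal_set_def)
  have le: "expected_profit x p q V c \<le> PPTP n x p q c" if "V \<subseteq> {1..n}" for V
    using that unfolding PPTP_def by (intro Max_ge) auto
  have "PPTP n x p q c + PPTP n x p q c
      \<le> expected_profit x p q (S \<union> T) c + expected_profit x p q (S \<inter> T) c"
    using expected_profit_supermodular[OF sub(1,2) c] assms by (simp add: optimal_set_def)
  with le[OF sub(3)] le[OF sub(4)]
  have "expected_profit x p q (S \<union> T) c = PPTP n x p q c"
    "expected_profit x p q (S \<inter> T) c = PPTP n x p q c"
    by linarith+
  then show "optimal_set n x p q c (S \<union> T)" "optimal_set n x p q c (S \<inter> T)"
    using sub c by (auto simp: optimal_set_def)
qed

lemma finite_optimal_sets: "finite {S. optimal_set n x p q c S}"
  by (rule finite_subset[of _ "Pow {1..n}"]) (auto simp: optimal_set_def)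

lemma
  assumes "optimal_set n x p q c S"
  shows maximal_optimal_set_optimal: "optimal_set n x p q c (maximal_optimal_set n x p q c)"
    and maximal_optimal_set_greatest: "S \<subseteq> maximal_optimal_set n x p q c"
proof -
  let ?\<O> = "{S. optimal_set n x p q c S}"
  have "\<Union>?\<O> \<in> ?\<O>"
    by (rule finite_Sup_in[OF finite_optimal_sets]) (use assms optimal_set_Un_Int in auto)
  then have opt: "optimal_set n x p q c (\<Union>?\<O>)"
    by simp
  have "maximal_optimal_set n x p q c = \<Union>?\<O>"
    unfolding maximal_optimal_set_def
  proof (rule the_equality)
    show "optimal_set n x p q c (\<Union>?\<O>) \<and> (\<nexists>T. optimal_set n x p q c T \<and> \<Union>?\<O> \<subset> T)"
      using opt by blast
  next
    fix V assume "optimal_set n x p q c V \<and> (\<nexists>T. optimal_set n x p q c T \<and> V \<subset> T)"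
    then show "V = \<Union>?\<O>"
      using opt by blast
  qed
  then show "optimal_set n x p q c (maximal_optimal_set n x p q c)"
    and "S \<subseteq> maximal_optimal_set n x p q c"
    using opt assms by auto
qed

lemma
  assumes "optimal_set n x p q c S"
  shows minimal_optimal_set_optimal: "optimal_set n x p q c (minimal_optimal_set n x p q c)"
    and minimal_optimal_set_least: "minimal_optimal_set n x p q c \<subseteq> S"
proof -
  let ?\<O> = "{S. optimal_set n x p q c S}"
  have "\<Inter>?\<O> \<in> ?\<O>"
    by (rule finite_Inf_in[OF finite_optimal_sets]) (use assms optimal_set_Un_Int in auto)
  then have opt: "optimal_set n x p q c (\<Inter>?\<O>)"
    by simp
  have "minimal_optimal_set n x p q c = \<Inter>?\<O>"
    unfolding minimal_optimal_set_def
  proof (rule the_equality)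
    show "optimal_set n x p q c (\<Inter>?\<O>) \<and> (\<nexists>T. optimal_set n x p q c T \<and> T \<subset> \<Inter>?\<O>)"
      using opt by blast
  next
    fix V assume "optimal_set n x p q c V \<and> (\<nexists>T. optimal_set n x p q c T \<and> T \<subset> V)"
    then show "V = \<Inter>?\<O>"
      using opt by blast
  qed
  then show "optimal_set n x p q c (minimal_optimal_set n x p q c)"
    and "minimal_optimal_set n x p q c \<subseteq> S"
    using opt assms by auto
qed

text \<open>
  Both sets have the same profit, so the larger revenue of the larger set is paid for
  by a larger distance.
\<close>

lemma optimal_sets_strict_mono_distance:
  assumes "optimal_set n x p q c S" "optimal_set n x p q c T" "S \<subset> T"
  shows "0 < c" "expected_distance x q S < expected_distance x q T"
proof -
  have "expected_revenue p q S < expected_revenue p q T"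
    using assms by (intro expected_revenue_strict_mono) (auto simp: optimal_set_def)
  moreover have "expected_profit x p q S c = expected_profit x p q T c" "0 \<le> c"
    using assms by (auto simp: optimal_set_def)
  ultimately have less: "c * expected_distance x q S < c * expected_distance x q T" and "0 \<le> c"
    by (auto simp: expected_profit_def)
  show "0 < c"
    using less \<open>0 \<le> c\<close> by (cases "c = 0") auto
  then show "expected_distance x q S < expected_distance x q T"
    using less by simp
qed

end

section \<open>Optimal sets for nearby unit costs\<close>

text \<open>
  A set that is not optimal for \<open>c\<^sub>0\<close> stays strictly worse than \<open>M\<close> on a neighbourhood of \<open>c\<^sub>0\<close>, by
  continuity; a set that is optimal for \<open>c\<^sub>0\<close> is compared with \<open>M\<close> through the slope alone. The set
  \<open>D\<close> stands for either side of \<open>c\<^sub>0\<close>.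
\<close>

lemma eventually_optimal_set:
  assumes "0 < c\<^sub>0" and opt: "optimal_set n x p q c\<^sub>0 M"
    and slope: "\<And>S c. optimal_set n x p q c\<^sub>0 S \<Longrightarrow> c \<in> D \<Longrightarrow>
      (c - c\<^sub>0) * expected_distance x q M \<le> (c - c\<^sub>0) * expected_distance x q S"
  shows "eventually (\<lambda>c. optimal_set n x p q c M) (at c\<^sub>0 within D)"
proof -
  let ?G = "expected_profit x p q"
  have affine: "?G S c = ?G S c\<^sub>0 - (c - c\<^sub>0) * expected_distance x q S" for S c
    by (simp add: expected_profit_def algebra_simps)
  have in_D: "eventually (\<lambda>c. c \<in> D) (at c\<^sub>0 within D)"
    by (simp add: eventually_at_filter)
  have "eventually (\<lambda>c. ?G S c \<le> ?G M c) (at c\<^sub>0 within D)" if S: "S \<subseteq> {1..n}" for S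
  proof (cases "optimal_set n x p q c\<^sub>0 S")
    case True
    then have "?G S c\<^sub>0 = ?G M c\<^sub>0"
      using opt by (simp add: optimal_set_def)
    then have "?G S c \<le> ?G M c" if "c \<in> D" for c
      using slope[OF True that] affine[of S c] affine[of M c] by linarith
    then show ?thesis
      using in_D by (auto elim: eventually_mono)
  next
    case False
    have "?G S c\<^sub>0 \<le> ?G M c\<^sub>0"
      using opt S by (auto simp: optimal_set_iff)
    moreover have "?G S c\<^sub>0 \<noteq> ?G M c\<^sub>0"
      using False opt S by (auto simp: optimal_set_def)
    ultimately have "0 < ?G M c\<^sub>0 - ?G S c\<^sub>0"
      by simp
    moreover have "((\<lambda>c. ?G M c - ?G S c) \<longlongrightarrow> ?G M c\<^sub>0 - ?G S c\<^sub>0) (at c\<^sub>0 within D)"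
      unfolding expected_profit_def by (intro tendsto_intros)
    ultimately have "eventually (\<lambda>c. 0 < ?G M c - ?G S c) (at c\<^sub>0 within D)"
      by (rule order_tendstoD(1)[rotated])
    then show ?thesis
      by (rule eventually_mono) simp
  qed
  then have "eventually (\<lambda>c. \<forall>S\<in>Pow {1..n}. ?G S c \<le> ?G M c) (at c\<^sub>0 within D)"
    by (intro eventually_ball_finite) auto
  moreover have "eventually (\<lambda>c. 0 < c) (at c\<^sub>0 within D)"
    using \<open>0 < c\<^sub>0\<close> by (intro order_tendstoD(1)[OF tendsto_ident_at])
  ultimately show ?thesis
    by eventually_elim (use opt in \<open>auto simp: optimal_set_iff\<close>)
qed

lemma PPTP_has_derivative_within:
  assumes "optimal_set n x p q c\<^sub>0 M"
    and "eventually (\<lambda>c. optimal_set n x p q c M) (at c\<^sub>0 within D)"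
  shows "(PPTP n x p q has_real_derivative - expected_distance x q M) (at c\<^sub>0 within D)"
proof -
  have "(expected_profit x p q M has_real_derivative - expected_distance x q M) (at c\<^sub>0 within D)"
    unfolding expected_profit_def[abs_def] by (auto intro!: derivative_eq_intros)
  moreover have "eventually (\<lambda>c. expected_profit x p q M c = PPTP n x p q c) (at c\<^sub>0 within D)"
    using assms(2) by (rule eventually_mono) (simp add: optimal_set_def)
  moreover have "expected_profit x p q M c\<^sub>0 = PPTP n x p q c\<^sub>0"
    using assms(1) by (simp add: optimal_set_def)
  ultimately show ?thesis
    by (simp add: has_field_derivative_cong_eventually)
qed

theorem proposition9:
  fixes n :: nat and x p q :: "nat \<Rightarrow> real" and cbar :: real
  assumes "pptp_line n x p q"
    and "0 \<le> cbar"
    and "\<exists>S T. optimal_set n x p q cbar S \<and> optimal_set n x p q cbar T \<and> S \<noteq> T"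
  shows "(\<exists>\<epsilon>>0.
            (\<forall>c\<in>{cbar - \<epsilon><..cbar}. optimal_set n x p q c (maximal_optimal_set n x p q cbar)) \<and>
            (\<forall>c\<in>{cbar..<cbar + \<epsilon>}. optimal_set n x p q c (minimal_optimal_set n x p q cbar)))
         \<and> corner_point (PPTP n x p q) cbar"
proof -
  interpret pptp_line n x p q by fact
  let ?L = "expected_distance x q"
  define H where "H = maximal_optimal_set n x p q cbar"
  define K where "K = minimal_optimal_set n x p q cbar"
  obtain S T where ST: "optimal_set n x p q cbar S" "optimal_set n x p q cbar T" "S \<noteq> T"
    using assms by blast
  have opt: "optimal_set n x p q cbar H" "optimal_set n x p q cbar K"
    unfolding H_def K_def
    using ST maximal_optimal_set_optimal minimal_optimal_set_optimal by blast+
  have between: "K \<subseteq> V" "V \<subseteq> H" if "optimal_set n x p q cbar V" for V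
    unfolding H_def K_def
    using that maximal_optimal_set_greatest minimal_optimal_set_least by blast+
  have "K \<subset> H"
    using between[OF ST(1)] between[OF ST(2)] ST(3) by blast
  note KH = optimal_sets_strict_mono_distance[OF opt(2,1) this]
  have L_between: "?L K \<le> ?L V" "?L V \<le> ?L H" if "optimal_set n x p q cbar V" for V
    using between[OF that] optimal_sets_strict_mono_distance(2)[OF opt(2) that]
      optimal_sets_strict_mono_distance(2)[OF that opt(1)]
    by (auto simp: less_le)
  have left: "eventually (\<lambda>c. optimal_set n x p q c H) (at_left cbar)"
    using L_between by (intro eventually_optimal_set KH(1) opt) (auto intro: mult_left_mono_neg)
  have right: "eventually (\<lambda>c. optimal_set n x p q c K) (at_right cbar)"
    using L_between by (intro eventually_optimal_set KH(1) opt) (auto intro: mult_left_mono)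
  obtain a where a: "a < cbar" "\<And>c. a < c \<Longrightarrow> c < cbar \<Longrightarrow> optimal_set n x p q c H"
    using left by (auto simp: eventually_at_left_field)
  obtain b where b: "cbar < b" "\<And>c. cbar < c \<Longrightarrow> c < b \<Longrightarrow> optimal_set n x p q c K"
    using right by (auto simp: eventually_at_right_field)
  define \<epsilon> where "\<epsilon> = min (cbar - a) (b - cbar)"
  have "0 < \<epsilon>"
    using a(1) b(1) by (simp add: \<epsilon>_def)
  moreover have "optimal_set n x p q c H" if "c \<in> {cbar - \<epsilon><..cbar}" for c
    using that a(2)[of c] opt(1) by (cases "c = cbar") (auto simp: \<epsilon>_def)
  moreover have "optimal_set n x p q c K" if "c \<in> {cbar..<cbar + \<epsilon>}" for c
    using that b(2)[of c] opt(2) by (cases "c = cbar") (auto simp: \<epsilon>_def)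
  moreover have "corner_point (PPTP n x p q) cbar"
    unfolding corner_point_def
    using PPTP_has_derivative_within[OF opt(1) left] PPTP_has_derivative_within[OF opt(2) right] KH
    by force
  ultimately show ?thesis
    unfolding H_def K_def by blast
qed

end
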